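(* Let $0<s<m$, let $t$ be a legitimate quadruple, and let $l\in L^*\setminus(L^* )^{\sigma-1}$ (so $l\neq0$). Let $S$ be a semifield isotopic to $B(2,m,s,l,t)$. Then the center, the left nucleus and the right nucleus of $S$ coincide, and they are isomorphic to $K_1=\mathbb{F}_{2^{\gcd(m,s)}}$.
   Context: A (finite) presemifield is a finite additive abelian group with a multiplication that is distributive on both sides over addition and has no zero divisors; it is a semifield if it also has a multiplicative identity. Two presemifields $(F,+,* )$ and $(F,+,\circ)$ are isotopic if there are additive bijections $\alpha_1,\alpha_2,\beta$ with $\beta(\alpha_1(x)*\alpha_2(y))=x\circ y$ for all $x,y$. In a semifield, an element $u$ belongs to the left, middle, right nucleus if, respectively, $u*(y*w)=(u*y)*w$, $y*(u*w)=(y*u)*w$, $y*(w*u)=(y*w)*u$ for all $y,w$; the center consists of the elements in all three nuclei that commute with every element. Let $m\ge 1$, $L=GF(2^m)$, $\sigma=2^s$, $(L^* )^{\sigma-1}=\{u^{\sigma-1}:u\in L^*\}$. A quadruple $t=[p_1,p_2,p_3,p_4]\in L^4$ is legitimate if $p_1\neq0$ and $p_1X^{\sigma+1}+p_2X^{\sigma}+p_3X+p_4$ has no root in $L$. $B(2,m,s,l,t)$ is the presemifield on $L\times L$ with multiplication $$(a,b)\circ(c,d)=(p_1ac^{\sigma}+lp_1a^{\sigma}c+p_2bc^{\sigma}+lp_2a^{\sigma}d+p_3ad^{\sigma}+lp_3b^{\sigma}c+p_4bd^{\sigma}+lp_4b^{\sigma}d,\ ad+bc).$$ *)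

theory Defs
  imports Complex_Main "HOL-Library.Product_Plus" "HOL-Algebra.QuotRing"
begin

locale presemifield =
  fixes star :: "'b::{ab_group_add,finite} \<Rightarrow> 'b \<Rightarrow> 'b"
  assumes distrib_left_star: "star x (y + z) = star x y + star x z"
    and distrib_right_star: "star (x + y) z = star x z + star y z"
    and no_zero_divisors_star: "star x y = 0 \<Longrightarrow> x = 0 \<or> y = 0"

definition is_identity :: "('b \<Rightarrow> 'b \<Rightarrow> 'b) \<Rightarrow> 'b \<Rightarrow> bool" where
  "is_identity star e \<longleftrightarrow> (\<forall>x. star e x = x \<and> star x e = x)"

locale semifield = presemifield +
  assumes ex_identity: "\<exists>e. is_identity star e"

text \<open>The two additive groups are allowed to live on different types, so that a semifield
  on an arbitrary type can be compared with a multiplication on \<open>L \<times> L\<close>.\<close>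

definition isotopic ::
  "('b::ab_group_add \<Rightarrow> 'b \<Rightarrow> 'b) \<Rightarrow> ('c::ab_group_add \<Rightarrow> 'c \<Rightarrow> 'c) \<Rightarrow> bool" where
  "isotopic star circ \<longleftrightarrow>
     (\<exists>\<alpha>1 \<alpha>2 \<beta>. additive \<alpha>1 \<and> bij \<alpha>1 \<and> additive \<alpha>2 \<and> bij \<alpha>2 \<and> additive \<beta> \<and> bij \<beta> \<and>
        (\<forall>x y. \<beta> (star (\<alpha>1 x) (\<alpha>2 y)) = circ x y))"

definition left_nucleus :: "('b \<Rightarrow> 'b \<Rightarrow> 'b) \<Rightarrow> 'b set" where
  "left_nucleus star = {u. \<forall>y w. star u (star y w) = star (star u y) w}"

definition middle_nucleus :: "('b \<Rightarrow> 'b \<Rightarrow> 'b) \<Rightarrow> 'b set" where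
  "middle_nucleus star = {u. \<forall>y w. star y (star u w) = star (star y u) w}"

definition right_nucleus :: "('b \<Rightarrow> 'b \<Rightarrow> 'b) \<Rightarrow> 'b set" where
  "right_nucleus star = {u. \<forall>y w. star y (star w u) = star (star y w) u}"

definition center :: "('b \<Rightarrow> 'b \<Rightarrow> 'b) \<Rightarrow> 'b set" where
  "center star =
     {u \<in> left_nucleus star \<inter> middle_nucleus star \<inter> right_nucleus star.
        \<forall>y. star u y = star y u}"

text \<open>A subset of a semifield with the inherited operations, as a record of HOL-Algebra.
  The identity of a semifield is unique, so the description operator is well defined there.\<close>

definition substructure :: "('b::ab_group_add \<Rightarrow> 'b \<Rightarrow> 'b) \<Rightarrow> 'b set \<Rightarrow> 'b ring" where
  "substructure star N =
     \<lparr>carrier = N, mult = star, one = (THE e. is_identity star e), zero = 0, add = (+)\<rparr>"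

fun legitimate :: "nat \<Rightarrow> 'a::field \<times> 'a \<times> 'a \<times> 'a \<Rightarrow> bool" where
  "legitimate s (p1, p2, p3, p4) \<longleftrightarrow>
     p1 \<noteq> 0 \<and>
     \<not> (\<exists>x. p1 * x ^ (2 ^ s + 1) + p2 * x ^ (2 ^ s) + p3 * x + p4 = 0)"

text \<open>The multiplication of \<open>B(2,m,s,l,t)\<close>; the parameter \<open>m\<close> is carried by the type,
  which is the field \<open>L\<close> with \<open>2^m\<close> elements.\<close>

fun B_mult :: "nat \<Rightarrow> 'a::field \<Rightarrow> 'a \<times> 'a \<times> 'a \<times> 'a \<Rightarrow> 'a \<times> 'a \<Rightarrow> 'a \<times> 'a \<Rightarrow> 'a \<times> 'a" where
  "B_mult s l (p1, p2, p3, p4) (a, b) (c, d) =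
     (let \<sigma> = 2 ^ s in
      (p1 * a * c ^ \<sigma> + l * p1 * a ^ \<sigma> * c
       + p2 * b * c ^ \<sigma> + l * p2 * a ^ \<sigma> * d
       + p3 * a * d ^ \<sigma> + l * p3 * b ^ \<sigma> * c
       + p4 * b * d ^ \<sigma> + l * p4 * b ^ \<sigma> * d,
       a * d + b * c))"

end

theory Submission
  imports Defs "HOL-Computational_Algebra.Polynomial"
    "HOL-Algebra.Multiplicative_Group" "HOL-Library.Z2"
begin

text \<open>Write \<open>x \<circ> y = (B(x, \<sigma> y) + l B(y, \<sigma> x), det(x, y))\<close> for the bilinear form \<open>B\<close> with
  coefficients \<open>p1, p2, p3, p4\<close>. Up to isotopism, an element of the left nucleus is a pair of additive
  maps with \<open>T (x \<circ> y) = U x \<circ> y\<close>. The second component of this equation is linear in \<open>y\<close>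
  over the whole field, which forces the second component of \<open>T\<close> to depend only on the determinant;
  hence \<open>U\<close> is multiplication by a scalar \<open>k\<close>. The same rigidity applied to the first component
  gives \<open>\<sigma> k = k\<close>. Exchanging the factors replaces \<open>l\<close> by its inverse, which settles the right nucleus,
  and conversely the scalars fixed by \<open>\<sigma>\<close> yield central elements.\<close>

section \<open>Autotopisms and isotopes of a twisted form\<close>

lemma additive_inv:
  assumes "additive f" "bij f" shows "additive (inv_into UNIV f)"
proof
  fix x y
  have "f (inv_into UNIV f x + inv_into UNIV f y) = x + y"
    using assms by (simp add: additive.add bij_is_surj surj_f_inv_f)
  then show "inv_into UNIV f (x + y) = inv_into UNIV f x + inv_into UNIV f y"
    using assms by (metis bij_is_inj inv_f_f)
qed

text \<open>The Frobenius power is abstracted to a nontrivial field endomorphism.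
  \<open>sigma_neq_l\<close> says that \<open>l\<close> is not of the form
  \<open>u^(\<sigma>-1)\<close>, and \<open>no_root\<close> is legitimacy. This permits a second
  instance with \<open>l\<close> inverted, for the opposite multiplication.\<close>

locale twisted_form =
  fixes \<sigma> :: "'a::{field,finite} \<Rightarrow> 'a" and l p1 p2 p3 p4 :: 'a
  assumes two_zero: "(2::'a) = 0"
    and sigma_add: "\<sigma> (x + y) = \<sigma> x + \<sigma> y"
    and sigma_mult: "\<sigma> (x * y) = \<sigma> x * \<sigma> y"
    and sigma_one: "\<sigma> 1 = 1"
    and sigma_nontrivial: "\<exists>x. \<sigma> x \<noteq> x"
    and l_nonzero: "l \<noteq> 0"
    and sigma_neq_l: "u \<noteq> 0 \<Longrightarrow> \<sigma> u \<noteq> l * u"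
    and p1_nonzero: "p1 \<noteq> 0"
    and no_root: "p1 * (x * \<sigma> x) + p2 * \<sigma> x + p3 * x + p4 \<noteq> 0"
begin

section \<open>Characteristic two and the arithmetic of \<open>\<sigma>\<close>\<close>

lemma add_self: "x + x = (0::'a)"
  using two_zero by (metis mult_2 mult_zero_left)

lemma add_self_left: "x + (x + y) = (y::'a)"
  by (simp add: add_self flip: add.assoc)

lemma add_eq_zero_iff: "x + y = 0 \<longleftrightarrow> x = (y::'a)"
  by (metis add_self add_self_left add.right_neutral)

lemmas char2_simps = algebra_simps two_zero add_self add_self_left

lemma sigma_zero: "\<sigma> 0 = 0"
  using sigma_add[of 0 0] by (simp add: add_self)

lemma sigma_eq_zero: "\<sigma> x = 0 \<Longrightarrow> x = 0"
  by (metis mult_zero_left right_inverse sigma_mult sigma_one zero_neq_one)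

text \<open>Squaring is additive with trivial kernel, so it is injective and hence onto the finite
  field.\<close>

lemma ex_square_root: "\<exists>g::'a. g * g = f"
proof -
  have "inj (\<lambda>g::'a. g * g)"
  proof (rule injI)
    fix x y :: 'a assume "x * x = y * y"
    then have "(x + y) * (x + y) = 0" by (simp add: char2_simps)
    then show "x = y" by (simp add: add_eq_zero_iff)
  qed
  then have "surj (\<lambda>g::'a. g * g)" by (simp add: finite_UNIV_inj_surj)
  then show ?thesis by (metis surjD)
qed

text \<open>Up to the factor \<open>p1 * (a * \<sigma> a)\<close> this is the first component of the
  product of \<open>(a, 0)\<close> and \<open>(a * x, 0)\<close>. It is bijective because a nonzero
  kernel element would solve \<open>\<sigma> u = l * u\<close>.\<close>

definition h :: "'a \<Rightarrow> 'a" where "h x = \<sigma> x + l * x"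

lemma h_add: "h (x + y) = h x + h y"
  by (simp add: h_def sigma_add algebra_simps)

lemma surj_h: "surj h"
proof -
  have "inj h"
  proof (rule injI)
    fix x y assume "h x = h y"
    then have "h (x + y) = 0" by (simp add: h_add add_self)
    then show "x = y" using sigma_neq_l[of "x + y"] by (auto simp: h_def add_eq_zero_iff)
  qed
  then show ?thesis by (simp add: finite_UNIV_inj_surj)
qed

text \<open>The point 1 gives \<open>C = r\<close>; cancelling a nonzero \<open>C\<close> would make
  \<open>\<sigma>\<close> the identity. Later arguments use this to kill coefficients of
  \<open>\<sigma> x\<close>.\<close>

lemma sigma_linear_zero:
  assumes "\<And>x. C * \<sigma> x = r * x" shows "C = 0"
proof (rule ccontr)
  assume "C \<noteq> 0"
  have "C = r" using assms[of 1] by (simp add: sigma_one)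
  with assms \<open>C \<noteq> 0\<close> have "\<sigma> x = x" for x by (metis mult_left_cancel)
  with sigma_nontrivial show False by blast
qed

text \<open>Compare the coefficients of \<open>\<sigma> x\<close> and \<open>x\<close>: they give
  \<open>n = \<sigma> c\<close> and \<open>l * n = l * c\<close>.\<close>

lemma sigma_fixed_of_h:
  assumes "\<And>x. n * h x = h (c * x)" shows "\<sigma> n = n" "c = n"
proof -
  have "(n + \<sigma> c) * \<sigma> x = (l * (n + c)) * x" for x
  proof -
    have "n * h x + h (c * x) = 0" using assms by (simp add: add_self)
    then have "(n + \<sigma> c) * \<sigma> x + (l * (n + c)) * x = 0"
      by (simp add: h_def sigma_mult algebra_simps)
    then show ?thesis by (simp add: add_eq_zero_iff)
  qed
  note * = this
  from sigma_linear_zero[OF this] have "n = \<sigma> c" by (simp add: add_eq_zero_iff)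
  moreover from this *[of 1] have "n = c" using l_nonzero
    by (simp add: sigma_one add_self add_eq_zero_iff)
  ultimately show "\<sigma> n = n" "c = n" by auto
qed

lemma norm_fixed_imp_involution:
  assumes "\<And>a. a \<noteq> 0 \<Longrightarrow> \<sigma> (a * \<sigma> a) = a * \<sigma> a" shows "\<sigma> (\<sigma> a) = a"
  using assms[of a] sigma_eq_zero[of a] by (cases "a = 0") (auto simp: sigma_mult sigma_zero)

text \<open>If \<open>l * \<sigma> l = 1\<close>, then \<open>\<sigma>\<close> multiplies every
  value of \<open>h\<close> by \<open>\<sigma> l\<close>. As \<open>h\<close> is onto,
  \<open>\<sigma>\<close> is then a scalar multiplication, and its value at 1 makes it the
  identity.\<close>

lemma norm_l_neq_one:
  assumes inv: "\<And>a. \<sigma> (\<sigma> a) = a" shows "1 + l * \<sigma> l \<noteq> 0"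
proof
  assume "1 + l * \<sigma> l = 0"
  then have "l * \<sigma> l = 1" using add_eq_zero_iff by force
  then have *: "\<sigma> l * (l * x) = x" for x by (metis mult.assoc mult.commute mult_1)
  have "\<sigma> (h x) = \<sigma> l * h x" for x
    by (simp add: h_def sigma_add sigma_mult inv distrib_left * add.commute)
  then have s: "\<sigma> z = \<sigma> l * z" for z using surj_h by (metis surjD)
  from s[of 1] have "\<sigma> l = 1" by (simp add: sigma_one)
  with s sigma_nontrivial show False by simp
qed

section \<open>Additive functionals of the first component \<open>F\<close>\<close>

definition F :: "'a \<Rightarrow> 'a \<Rightarrow> 'a \<Rightarrow> 'a \<Rightarrow> 'a" where
  "F a b c d = p1 * a * \<sigma> c + l * p1 * \<sigma> a * c + p2 * b * \<sigma> c + l * p2 * \<sigma> a * d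
     + p3 * a * \<sigma> d + l * p3 * \<sigma> b * c + p4 * b * \<sigma> d + l * p4 * \<sigma> b * d"

lemma F_parallel: "F a 0 (a * x) 0 = p1 * (a * \<sigma> a * h x)"
  by (simp add: F_def h_def sigma_zero sigma_mult algebra_simps)

text \<open>Otherwise the polynomial, divided by \<open>p1\<close>, would be \<open>N(X + P2) + f\<close> with
  \<open>N(x) = x * \<sigma> x\<close> and \<open>f\<close> fixed by \<open>\<sigma>\<close>; in characteristic 2 the square root \<open>g\<close> of \<open>f\<close> is
  also fixed, so \<open>N(g) = f\<close> and there is a root.\<close>

lemma not_hermitian:
  assumes inv: "\<And>a. \<sigma> (\<sigma> a) = a"
  shows "\<not> (p3 / p1 = \<sigma> (p2 / p1) \<and> \<sigma> (p4 / p1) = p4 / p1)"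
proof
  define P2 P4 where P: "P2 = p2 / p1" "P4 = p4 / p1"
  assume "p3 / p1 = \<sigma> (p2 / p1) \<and> \<sigma> (p4 / p1) = p4 / p1"
  then have p: "p2 = p1 * P2" "p3 = p1 * \<sigma> P2" "p4 = p1 * P4" "\<sigma> P4 = P4"
    using p1_nonzero by (auto simp: P field_simps)
  obtain g where g: "g * g = P4 + P2 * \<sigma> P2" using ex_square_root by blast
  have "\<sigma> g * \<sigma> g = g * g"
    by (simp add: g sigma_add sigma_mult inv p flip: sigma_mult) (simp add: sigma_mult inv)
  then have "(\<sigma> g + g) * (\<sigma> g + g) = 0" by (simp add: char2_simps)
  then have sg: "\<sigma> g = g" by (simp add: add_eq_zero_iff)
  have "p1 * ((g + P2) * \<sigma> (g + P2)) + p2 * \<sigma> (g + P2) + p3 * (g + P2) + p4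
      = p1 * (g * g + P4 + P2 * \<sigma> P2)"
    by (simp add: p sg sigma_add char2_simps)
  also have "\<dots> = 0" by (simp add: g char2_simps)
  finally show False using no_root by blast
qed

text \<open>On parallel arguments the hypothesis forces \<open>\<tau>\<close> to be a multiple of the inverse of \<open>h\<close>.
  A nonzero multiple implies first that \<open>\<sigma>\<close> is an involution and then the symmetry excluded by
  \<open>not_hermitian\<close>.\<close>

lemma functional_zero:
  assumes tau: "additive \<tau>" and rho: "additive \<rho>"
    and lin: "\<And>a b. \<exists>u v. \<forall>c d. \<tau> (F a b c d) + \<rho> (a * d + b * c) = u * c + v * d"
  shows "\<tau> z = 0"
proof (rule ccontr)
  assume nz: "\<tau> z \<noteq> 0"
  have rho0: "\<rho> 0 = 0" using rho by (simp add: additive.zero)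
  \<comment> \<open>For \<open>b = d = 0\<close> the determinant vanishes and \<open>\<rho>\<close>
    drops out.\<close>
  have "\<exists>w. \<forall>c. \<tau> (F a 0 c 0) = w * c" for a
  proof -
    obtain u v' where "\<forall>c d. \<tau> (F a 0 c d) + \<rho> (a * d + 0 * c) = u * c + v' * d"
      using lin by blast
    then have "\<tau> (F a 0 c 0) = u * c" for c by (metis add.right_neutral mult_zero_left mult_zero_right rho0)
    then show ?thesis by blast
  qed
  then obtain w where w: "\<And>a c. \<tau> (F a 0 c 0) = w a * c" by metis
  define v where "v = w 1"
  have v: "\<tau> (p1 * h x) = v * x" for x
    using w[of 1 x] F_parallel[of 1 x] by (simp add: sigma_one v_def)
  have "v \<noteq> 0"
  proof
    assume "v = 0"
    moreover obtain x where "z / p1 = h x" using surj_h by (metis surjD)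
    ultimately show False using v[of x] nz p1_nonzero by (metis mult_zero_left nonzero_mult_div_cancel_left times_divide_eq_right)
  qed
  have inv: "\<sigma> (\<sigma> a) = a" for a
  proof (rule norm_fixed_imp_involution)
    fix a :: 'a assume "a \<noteq> 0"
    \<comment> \<open>Under \<open>h\<close>, multiplication by \<open>a * \<sigma> a\<close>
      corresponds to multiplication by a constant, as \<open>sigma_fixed_of_h\<close>
      requires.\<close>
    have "(a * \<sigma> a) * h x = h ((w a * a / v) * x)" for x
    proof -
      obtain y where y: "(a * \<sigma> a) * h x = h y" using surj_h by (metis surjD)
      have "w a * (a * x) = v * y"
        using w[of a "a * x"] F_parallel[of a x] v[of y] by (simp add: y)
      then have "y = (w a * a / v) * x" using \<open>v \<noteq> 0\<close> by (simp add: field_simps)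
      with y show ?thesis by simp
    qed
    then show "\<sigma> (a * \<sigma> a) = a * \<sigma> a" by (rule sigma_fixed_of_h)
  qed
  define D where "D = 1 + l * \<sigma> l"
  have "D \<noteq> 0" unfolding D_def using norm_l_neq_one inv by blast
  \<comment> \<open>For an involution, \<open>\<sigma> (h x) + \<sigma> l * h x = D * x\<close>,
    which inverts \<open>h\<close> explicitly.\<close>
  have tau_eq: "D * \<tau> (p1 * z) = v * (\<sigma> z + \<sigma> l * z)" for z
  proof -
    obtain x where x: "z = h x" using surj_h by (metis surjD)
    have "\<sigma> z + \<sigma> l * z = D * x"
      by (simp add: x h_def D_def sigma_add sigma_mult inv char2_simps)
    then show ?thesis by (simp add: x v)
  qed
  define P2 P3 P4 where P: "P2 = p2 / p1" "P3 = p3 / p1" "P4 = p4 / p1"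
  then have p: "p2 = p1 * P2" "p3 = p1 * P3" "p4 = p1 * P4"
    using p1_nonzero by (auto simp: field_simps)
  define \<kappa> where "\<kappa> = v * \<sigma> l"
  have "\<kappa> \<noteq> 0" using \<open>v \<noteq> 0\<close> l_nonzero sigma_eq_zero by (auto simp: \<kappa>_def)
  \<comment> \<open>The defect of the symmetry \<open>P3 = \<sigma> P2\<close>; it enters the
    coefficient of \<open>\<sigma> d\<close> below.\<close>
  define e where "e = P3 + \<sigma> P2"
  have Fa: "F a 0 0 d = p1 * (l * P2 * \<sigma> a * d + P3 * a * \<sigma> d)" for a d
    unfolding F_def by (simp add: p sigma_zero algebra_simps)
  have Fb: "F 0 1 0 d = p1 * (P4 * \<sigma> d + l * P4 * d)" for d
    unfolding F_def by (simp add: p sigma_zero sigma_one algebra_simps)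
  have line: "\<exists>r. \<forall>d. \<kappa> * (a * e) * \<sigma> d + D * \<rho> (a * d) = r * d" for a
  proof -
    obtain u v' where uv: "\<And>c d. \<tau> (F a 0 c d) + \<rho> (a * d) = u * c + v' * d"
      using lin[of a 0] by auto
    have "\<kappa> * (a * e) * \<sigma> d + D * \<rho> (a * d)
        = (D * v' + v * (\<sigma> P3 * \<sigma> a + \<sigma> l * l * P2 * \<sigma> a)) * d" for d
    proof -
      have "D * (v' * d) = D * \<tau> (F a 0 0 d) + D * \<rho> (a * d)"
        using uv[of 0 d] by (simp flip: distrib_left)
      also have "D * \<tau> (F a 0 0 d) = v * (\<sigma> (l * P2 * \<sigma> a * d + P3 * a * \<sigma> d)
            + \<sigma> l * (l * P2 * \<sigma> a * d + P3 * a * \<sigma> d))"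
        unfolding Fa tau_eq ..
      finally show ?thesis
        by (simp add: \<kappa>_def e_def sigma_add sigma_mult inv char2_simps)
    qed
    then show ?thesis by blast
  qed
  from line[of 1] obtain r where r: "\<And>d. \<kappa> * e * \<sigma> d + D * \<rho> d = r * d" by auto
  \<comment> \<open>Replacing \<open>d\<close> by \<open>a * d\<close> in the equation for
    \<open>(1, 0)\<close> and adding the equation for \<open>(a, 0)\<close> cancels
    \<open>\<rho> (a * d)\<close>.\<close>
  have "e = 0"
  proof -
    obtain a where a: "\<sigma> a \<noteq> a" using sigma_nontrivial by blast
    obtain r' where r': "\<And>d. \<kappa> * (a * e) * \<sigma> d + D * \<rho> (a * d) = r' * d" using line[of a] by auto
    have "\<kappa> * e * (a + \<sigma> a) * \<sigma> d = (r' + r * a) * d" for d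
    proof -
      have "(r' + r * a) * d = (\<kappa> * (a * e) * \<sigma> d + D * \<rho> (a * d)) + (\<kappa> * e * \<sigma> (a * d) + D * \<rho> (a * d))"
        unfolding r r' by (simp add: algebra_simps)
      also have "\<dots> = \<kappa> * e * (a + \<sigma> a) * \<sigma> d" by (simp add: sigma_mult char2_simps)
      finally show ?thesis by simp
    qed
    then have "\<kappa> * e * (a + \<sigma> a) = 0" by (rule sigma_linear_zero)
    with a \<open>\<kappa> \<noteq> 0\<close> show ?thesis by (auto simp: add_eq_zero_iff)
  qed
  \<comment> \<open>The vectors \<open>(0, 1)\<close> and \<open>(0, d)\<close> are parallel, so
    \<open>\<rho>\<close> again contributes nothing.\<close>
  moreover have "\<sigma> P4 = P4"
  proof -
    obtain u v' where uv: "\<And>c d. \<tau> (F 0 1 c d) + \<rho> c = u * c + v' * d"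
      using lin[of 0 1] by auto
    have "\<kappa> * (\<sigma> P4 + P4) * \<sigma> d = (D * v' + v * (\<sigma> P4 + \<sigma> l * l * P4)) * d" for d
    proof -
      have "D * (v' * d) = D * \<tau> (F 0 1 0 d)" using uv[of 0 d] by (simp add: rho0)
      also have "\<dots> = v * (\<sigma> (P4 * \<sigma> d + l * P4 * d) + \<sigma> l * (P4 * \<sigma> d + l * P4 * d))"
        unfolding Fb tau_eq ..
      finally show ?thesis
        by (simp add: \<kappa>_def sigma_add sigma_mult inv char2_simps)
    qed
    then have "\<kappa> * (\<sigma> P4 + P4) = 0" by (rule sigma_linear_zero)
    with \<open>\<kappa> \<noteq> 0\<close> show ?thesis by (simp add: add_eq_zero_iff)
  qed
  ultimately show False
    using not_hermitian[OF inv] by (simp add: e_def add_eq_zero_iff P)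
qed

section \<open>Autotopisms acting on one factor\<close>

fun circ :: "'a \<times> 'a \<Rightarrow> 'a \<times> 'a \<Rightarrow> 'a \<times> 'a" where
  "circ (a, b) (c, d) = (F a b c d, a * d + b * c)"

lemma F_scale:
  assumes "\<sigma> k = k"
  shows "F (k * a) (k * b) c d = k * F a b c d" "F a b (k * c) (k * d) = k * F a b c d"
  by (simp_all add: F_def sigma_mult assms algebra_simps)

abbreviation scale :: "'a \<Rightarrow> 'a \<times> 'a \<Rightarrow> 'a \<times> 'a" where
  "scale k x \<equiv> (k * fst x, k * snd x)"

lemma left_autotopism_scalar:
  assumes T: "additive T" and eq: "\<And>x y. T (circ x y) = circ (U x) y"
  obtains k where "\<sigma> k = k" "\<And>x. U x = scale k x"
proof -
  define \<tau> \<rho> \<tau>' \<rho>' where "\<tau> x = snd (T (x, 0))" "\<rho> x = snd (T (0, x))"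
    "\<tau>' x = fst (T (x, 0))" "\<rho>' x = fst (T (0, x))" for x
  note defs = this
  have T_add: "T (a + a', b + b') = T (a, b) + T (a', b')" for a a' b b'
    using additive.add[OF T, of "(a, b)" "(a', b')"] by simp
  have add: "additive \<tau>" "additive \<rho>" "additive \<tau>'" "additive \<rho>'"
    using T_add[of _ _ 0 0] T_add[of 0 0] by (auto simp: additive_def defs)
  have T_split: "T (x, y) = (\<tau>' x + \<rho>' y, \<tau> x + \<rho> y)" for x y
    using T_add[of x 0 0 y] by (simp add: defs prod_eq_iff)
  define u v where "u a b = fst (U (a, b))" "v a b = snd (U (a, b))" for a b
  have U: "U (a, b) = (u a b, v a b)" for a b by (simp add: u_v_def)
  have E1: "\<tau>' (F a b c d) + \<rho>' (a * d + b * c) = F (u a b) (v a b) c d"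
    and E2: "\<tau> (F a b c d) + \<rho> (a * d + b * c) = u a b * d + v a b * c" for a b c d
    using eq[of "(a, b)" "(c, d)"] by (simp_all add: T_split U)
  have tau0: "\<tau> z = 0" for z
    using add(1,2)
  proof (rule functional_zero)
    show "\<exists>x y. \<forall>c d. \<tau> (F a b c d) + \<rho> (a * d + b * c) = x * c + y * d" for a b
      using E2 by (metis add.commute)
  qed
  \<comment> \<open>With \<open>\<tau> = 0\<close>, \<open>\<rho>\<close> sends the determinant of
    \<open>x, y\<close> to that of \<open>U x, y\<close>. Taking \<open>x = (1, 0)\<close> and
    \<open>y = (0, z)\<close> shows that \<open>\<rho>\<close> is multiplication by
    \<open>k\<close>.\<close>
  define k where "k = \<rho> 1"
  have "\<rho> z = k * z" for z
    using E2[of 1 0 0 z] E2[of 1 0 0 1] by (simp add: tau0 k_def)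
  then have uv: "u a b = k * a" "v a b = k * b" for a b
    using E2[of a b 0 1] E2[of a b 1 0] by (simp_all add: tau0)
  have "\<sigma> k = k"
  proof (rule ccontr)
    assume k: "\<sigma> k \<noteq> k"
    \<comment> \<open>\<open>G\<close> is \<open>B(y, \<sigma> x)\<close>. Scaling \<open>x\<close>
      by \<open>k\<close> multiplies \<open>B(x, \<sigma> y)\<close> by \<open>k\<close> but
      \<open>G\<close> by \<open>\<sigma> k\<close>; the discrepancy is \<open>q * G\<close>, which
      is linear in \<open>(c, d)\<close>.\<close>
    define G where "G a b c d = p1 * \<sigma> a * c + p2 * \<sigma> a * d + p3 * \<sigma> b * c + p4 * \<sigma> b * d" for a b c d
    define q where "q = (\<sigma> k + k) * l"
    have "q \<noteq> 0" using k l_nonzero by (simp add: q_def add_eq_zero_iff)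
    have E: "\<tau>' (F a b c d) + k * F a b c d + \<rho>' (a * d + b * c) = q * G a b c d" for a b c d
    proof -
      have "F (k * a) (k * b) c d = k * F a b c d + q * G a b c d"
        by (simp add: F_def G_def q_def sigma_mult char2_simps)
      then have "\<tau>' (F a b c d) + \<rho>' (a * d + b * c) = k * F a b c d + q * G a b c d"
        using E1[of a b c d] by (simp add: uv)
      then have "k * F a b c d + (\<tau>' (F a b c d) + \<rho>' (a * d + b * c)) = q * G a b c d"
        by (simp add: add_self_left)
      then show ?thesis by (simp add: ac_simps)
    qed
    \<comment> \<open>Absorbing \<open>k * F\<close> into \<open>\<tau>'\<close> leaves a side
      linear in \<open>(c, d)\<close>, so \<open>functional_zero\<close> applies to the first
      component too.\<close>
    define \<tau>'' where "\<tau>'' z = \<tau>' z + k * z" for z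
    have "additive \<tau>''" using add(3) by (auto simp: \<tau>''_def additive_def algebra_simps)
    then have "\<tau>'' z = 0" for z
      using add(4)
    proof (rule functional_zero)
      show "\<exists>x y. \<forall>c d. \<tau>'' (F a b c d) + \<rho>' (a * d + b * c) = x * c + y * d" for a b
        by (rule exI[of _ "q * (p1 * \<sigma> a + p3 * \<sigma> b)"], rule exI[of _ "q * (p2 * \<sigma> a + p4 * \<sigma> b)"])
          (simp add: \<tau>''_def E, simp add: G_def algebra_simps)
    qed
    \<comment> \<open>The determinant of \<open>(1, 0)\<close> with itself is 0, and
      \<open>G 1 0 1 0 = p1\<close>.\<close>
    then have "q * G 1 0 1 0 = \<rho>' 0" using E[of 1 0 1 0] by (simp add: \<tau>''_def)
    moreover have "\<rho>' 0 = 0" using add(4) by (simp add: additive.zero)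
    ultimately show False using \<open>q \<noteq> 0\<close> p1_nonzero by (simp add: G_def sigma_one sigma_zero)
  qed
  moreover have "U x = scale k x" for x by (cases x) (simp add: U uv)
  ultimately show thesis by (rule that)
qed

lemma circ_scale:
  assumes "\<sigma> k = k"
  shows "circ (scale k x) y = scale k (circ x y)" "circ x (scale k y) = scale k (circ x y)"
  by (cases x; cases y; simp add: F_scale[OF assms] distrib_left mult.assoc mult.left_commute[of _ k])+

text \<open>The condition on \<open>inverse l\<close> at \<open>u\<close> is the condition on
  \<open>l\<close> at \<open>inverse u\<close>.\<close>

lemma twisted_form_inverse: "twisted_form \<sigma> (inverse l) p1 p2 p3 p4"
proof
  fix u :: 'a assume "u \<noteq> 0"
  then have "\<sigma> (inverse u) * \<sigma> u = 1" by (simp add: sigma_one flip: sigma_mult)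
  then have inv_u: "\<sigma> (inverse u) = inverse (\<sigma> u)" by (metis inverse_unique mult.commute)
  show "\<sigma> u \<noteq> inverse l * u"
    using sigma_neq_l[of "inverse u"] \<open>u \<noteq> 0\<close> l_nonzero by (auto simp: inv_u)
qed (use two_zero sigma_add sigma_mult sigma_one sigma_nontrivial l_nonzero p1_nonzero no_root in auto)

text \<open>Exchanging the arguments of \<open>F\<close> inverts \<open>l\<close> and leaves a
  factor \<open>l\<close>, which \<open>M\<close> absorbs. Conjugating \<open>T\<close> by
  \<open>M\<close> turns a right autotopism into a left one of the opposite form.\<close>

lemma right_autotopism_scalar:
  assumes T: "additive T" and eq: "\<And>x y. T (circ x y) = circ x (U y)"
  obtains k where "\<sigma> k = k" "\<And>x. U x = scale k x"
proof -
  interpret opp: twisted_form \<sigma> "inverse l" p1 p2 p3 p4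
    by (rule twisted_form_inverse)
  define M where "M x = (l * fst x, snd x)" for x :: "'a \<times> 'a"
  define M' where "M' x = (inverse l * fst x, snd x)" for x :: "'a \<times> 'a"
  have M: "M' (M x) = x" for x using l_nonzero by (simp add: M_def M'_def mult.assoc[symmetric])
  have "F a b c d = l * opp.F c d a b" for a b c d
    unfolding F_def opp.F_def using l_nonzero by (simp add: field_simps)
  then have swap: "circ x y = M (opp.circ y x)" for x y
    by (cases x; cases y) (simp add: M_def ac_simps del: inverse_eq_divide)
  have "additive (\<lambda>x. M' (T (M x)))"
  proof
    fix x y
    have "M (x + y) = M x + M y" by (simp add: M_def algebra_simps)
    then show "M' (T (M (x + y))) = M' (T (M x)) + M' (T (M y))"
      using additive.add[OF T] by (simp add: M'_def algebra_simps)
  qed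
  moreover have "M' (T (M (opp.circ x y))) = opp.circ (U x) y" for x y
    using eq[of y x] by (simp add: swap M)
  ultimately obtain k where "\<sigma> k = k" "\<And>x. U x = scale k x"
    by (rule opp.left_autotopism_scalar) blast
  then show thesis by (rule that)
qed

text \<open>Under the isotopism the scalar \<open>k\<close> becomes multiplication by \<open>\<zeta> k\<close>.\<close>

lemma isotope_nuclei:
  fixes star :: "'b::{ab_group_add,finite} \<Rightarrow> 'b \<Rightarrow> 'b"
  assumes "semifield star" and "isotopic star circ"
  obtains \<zeta> :: "'a \<Rightarrow> 'b"
  where "inj \<zeta>" "is_identity star (\<zeta> 1)" "\<And>j k. \<zeta> (j + k) = \<zeta> j + \<zeta> k"
    "\<And>j k. \<sigma> j = j \<Longrightarrow> \<sigma> k = k \<Longrightarrow> \<zeta> (j * k) = star (\<zeta> j) (\<zeta> k)"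
    "center star = \<zeta> ` {k. \<sigma> k = k}" "left_nucleus star = \<zeta> ` {k. \<sigma> k = k}"
    "right_nucleus star = \<zeta> ` {k. \<sigma> k = k}"
proof -
  interpret semifield star by fact
  obtain e where e: "star e x = x" "star x e = x" for x
    using ex_identity by (auto simp: is_identity_def)
  obtain \<alpha>1 \<alpha>2 \<beta> where \<alpha>1: "additive \<alpha>1" "bij \<alpha>1" and \<alpha>2: "additive \<alpha>2" "bij \<alpha>2"
    and \<beta>: "additive \<beta>" "bij \<beta>" and iso: "\<And>x y. \<beta> (star (\<alpha>1 x) (\<alpha>2 y)) = circ x y"
    using \<open>isotopic star circ\<close> unfolding isotopic_def by blast
  note inv\<beta> = additive_inv[OF \<beta>]
  have inv_simps [simp]: "inv_into UNIV \<beta> (\<beta> X) = X" "\<beta> (inv_into UNIV \<beta> x) = x" "inv_into UNIV \<alpha>1 (\<alpha>1 x) = x" "\<alpha>1 (inv_into UNIV \<alpha>1 X) = X"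
    "inv_into UNIV \<alpha>2 (\<alpha>2 x) = x" "\<alpha>2 (inv_into UNIV \<alpha>2 X) = X" for x X
    using \<alpha>1 \<alpha>2 \<beta> by (simp_all add: bij_is_inj bij_is_surj surj_f_inv_f)
  define R where "R k X = inv_into UNIV \<beta> (scale k (\<beta> X))" for k X
  define \<zeta> where "\<zeta> k = R k e" for k
  have R_mult: "R (j * k) X = R j (R k X)" for j k X by (simp add: R_def mult.assoc)
  have R_add: "R (j + k) X = R j X + R k X" for j k X
    using additive.add[OF inv\<beta>, of "scale j (\<beta> X)" "scale k (\<beta> X)"] by (simp add: R_def distrib_right)
  have R_one: "R 1 X = X" for X by (simp add: R_def)
  \<comment> \<open>Putting the identity \<open>e\<close> for one factor shows that
    \<open>\<alpha>1\<close> and \<open>\<alpha>2\<close> carry scalars to the same maps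
    \<open>R k\<close> as \<open>\<beta>\<close> does.\<close>
  have R1: "\<alpha>1 (scale k x) = R k (\<alpha>1 x)" and R2: "\<alpha>2 (scale k y) = R k (\<alpha>2 y)"
    and Rl: "star (R k X) Y = R k (star X Y)" and Rr: "star X (R k Y) = R k (star X Y)"
    if k: "\<sigma> k = k" for k x y X Y
  proof -
    have R_eqI: "X = R k Y" if "\<beta> X = scale k (\<beta> Y)" for X Y
      using arg_cong[OF that, of "inv_into UNIV \<beta>"] by (simp only: R_def inv_simps)
    have l: "star (\<alpha>1 (scale k x)) (\<alpha>2 y) = R k (star (\<alpha>1 x) (\<alpha>2 y))"
      and r: "star (\<alpha>1 x) (\<alpha>2 (scale k y)) = R k (star (\<alpha>1 x) (\<alpha>2 y))" for x y
      by (rule R_eqI, simp only: iso circ_scale[OF k])+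
    show 1: "\<alpha>1 (scale k x) = R k (\<alpha>1 x)" for x using l[of x "inv_into UNIV \<alpha>2 e"] by (simp add: e)
    show 2: "\<alpha>2 (scale k y) = R k (\<alpha>2 y)" for y using r[of "inv_into UNIV \<alpha>1 e" y] by (simp add: e)
    show "star (R k X) Y = R k (star X Y)" "star X (R k Y) = R k (star X Y)"
      using l[of "inv_into UNIV \<alpha>1 X" "inv_into UNIV \<alpha>2 Y"] r[of "inv_into UNIV \<alpha>1 X" "inv_into UNIV \<alpha>2 Y"] by (simp_all only: 1 2 inv_simps)
  qed
  have \<zeta>: "star (\<zeta> k) X = R k X" "star X (\<zeta> k) = R k X" if "\<sigma> k = k" for k X
    using Rl Rr that by (simp_all add: \<zeta>_def e)
  let ?Z = "\<zeta> ` {k. \<sigma> k = k}"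
  have sub: "?Z \<subseteq> center star"
    by (auto simp: center_def left_nucleus_def middle_nucleus_def right_nucleus_def \<zeta> Rl Rr)
  have star_additive: "additive (star u)" "additive (\<lambda>x. star x u)" for u
    by (simp_all add: additive_def distrib_left_star distrib_right_star)
  have T_additive: "additive (\<lambda>x. \<beta> (f (inv_into UNIV \<beta> x)))" if "additive f" for f
    using that \<beta>(1) inv\<beta> by (simp add: additive_def)
  have left: "left_nucleus star \<subseteq> ?Z"
  proof
    fix u assume u: "u \<in> left_nucleus star"
    \<comment> \<open>Left multiplication by \<open>u\<close>, conjugated by \<open>\<beta>\<close>
      on products and by \<open>\<alpha>1\<close> on left factors, is a left autotopism.\<close>
    define U where "U x = inv_into UNIV \<alpha>1 (star u (\<alpha>1 x))" for x
    have *: "\<beta> (star u (inv_into UNIV \<beta> (circ x y))) = circ (U x) y" for x y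
      using u by (simp add: U_def left_nucleus_def flip: iso)
    obtain k where k: "\<sigma> k = k" "\<And>x. U x = scale k x"
      by (rule left_autotopism_scalar[OF T_additive[OF star_additive(1)] *]) blast
    have "star u (\<alpha>1 x) = \<alpha>1 (U x)" for x by (simp add: U_def)
    then have "star u (\<alpha>1 x) = R k (\<alpha>1 x)" for x by (simp only: k(2) R1[OF k(1)])
    from this[of "inv_into UNIV \<alpha>1 e"] have "u = \<zeta> k" by (simp add: e \<zeta>_def)
    with k show "u \<in> ?Z" by blast
  qed
  have right: "right_nucleus star \<subseteq> ?Z"
  proof
    fix u assume u: "u \<in> right_nucleus star"
    define U where "U y = inv_into UNIV \<alpha>2 (star (\<alpha>2 y) u)" for y
    have *: "\<beta> (star (inv_into UNIV \<beta> (circ x y)) u) = circ x (U y)" for x y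
      using u by (simp add: U_def right_nucleus_def flip: iso)
    obtain k where k: "\<sigma> k = k" "\<And>y. U y = scale k y"
      by (rule right_autotopism_scalar[OF T_additive[OF star_additive(2)] *]) blast
    have "star (\<alpha>2 y) u = \<alpha>2 (U y)" for y by (simp add: U_def)
    then have "star (\<alpha>2 y) u = R k (\<alpha>2 y)" for y by (simp only: k(2) R2[OF k(1)])
    from this[of "inv_into UNIV \<alpha>2 e"] have "u = \<zeta> k" by (simp add: e \<zeta>_def)
    with k show "u \<in> ?Z" by blast
  qed
  have \<zeta>_inj: "inj \<zeta>"
  proof (rule injI)
    fix j k assume "\<zeta> j = \<zeta> k"
    then have "\<beta> (\<zeta> j) = \<beta> (\<zeta> k)" by simp
    then have eq: "scale j (\<beta> e) = scale k (\<beta> e)" by (simp only: \<zeta>_def R_def inv_simps)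
    \<comment> \<open>If \<open>e = 0\<close>, the semifield is trivial, and so is
      \<open>'a \<times> 'a\<close>.\<close>
    have "\<beta> e \<noteq> 0"
    proof
      assume "\<beta> e = 0"
      then have "e = 0" using inv_simps(1)[of e] additive.zero[OF inv\<beta>] by simp
      then have X0: "X = 0" for X :: 'b using e(1)[of X] additive.zero[OF star_additive(2)[of X]] by simp
      have "x = 0" for x :: "'a \<times> 'a" using X0[of "inv_into UNIV \<beta> x"] inv_simps(2)[of x] additive.zero[OF \<beta>(1)] by simp
      from this[of "(1, 0)"] show False by (simp add: zero_prod_def)
    qed
    with eq show "j = k" by (auto simp: prod_eq_iff)
  qed
  have \<zeta>_one: "is_identity star (\<zeta> 1)" by (simp add: is_identity_def \<zeta>_def R_one e)
  have \<zeta>_add: "\<zeta> (j + k) = \<zeta> j + \<zeta> k" for j k by (simp add: \<zeta>_def R_add)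
  have \<zeta>_mult: "\<zeta> (j * k) = star (\<zeta> j) (\<zeta> k)" if "\<sigma> j = j" "\<sigma> k = k" for j k
    unfolding \<zeta>(1)[OF that(1)] by (simp add: \<zeta>_def R_mult)
  have "center star \<subseteq> left_nucleus star" "center star \<subseteq> right_nucleus star"
    by (auto simp: center_def)
  then have nuclei: "center star = ?Z" "left_nucleus star = ?Z" "right_nucleus star = ?Z"
    using sub left right by auto
  show thesis
    by (rule that[OF \<zeta>_inj \<zeta>_one \<zeta>_add \<zeta>_mult nuclei])
qed

end

section \<open>Finite fields of characteristic two\<close>

text \<open>Multiplication by a nonzero \<open>x\<close> permutes the nonzero elements; compare
  their products.\<close>

lemma power_card_UNIV:
  fixes x :: "'a::{field,finite}"
  shows "x ^ card (UNIV :: 'a set) = x"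
proof (cases "x = 0")
  case False
  let ?U = "UNIV - {0::'a}"
  have "bij_betw ((*) x) ?U ?U"
    using False by (intro bij_betw_byWitness[where f' = "(*) (inverse x)"]) auto
  then have "(\<Prod>y\<in>?U. y) = (\<Prod>y\<in>?U. x * y)"
    by (rule prod.reindex_bij_betw[symmetric])
  also have "\<dots> = x ^ card ?U * (\<Prod>y\<in>?U. y)" by (simp add: prod.distrib)
  finally have "x ^ card ?U = 1" by simp
  moreover have "card (UNIV :: 'a set) = Suc (card ?U)"
    by (rule card.remove) simp_all
  ultimately show ?thesis by (simp only: power_Suc mult_1_right)
qed (simp add: card_gt_0_iff)

lemma char_two_of_card:
  assumes "card (UNIV :: 'a::{field,finite} set) = 2 ^ m"
  shows "(2::'a) = 0"
proof -
  have "card {0, 1::'a} \<le> card (UNIV :: 'a set)" by (rule card_mono) auto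
  then have "m \<noteq> 0" using assms by (cases "m = 0") auto
  then have "(-1::'a) = 1" using power_card_UNIV[of "-1::'a"] assms by simp
  then show ?thesis by (metis add.right_inverse one_add_one)
qed

section \<open>Evaluation of polynomials over GF(2)\<close>

definition embed_bit :: "bit \<Rightarrow> 'a::zero_neq_one" where
  "embed_bit b = (if b = 0 then 0 else 1)"

lemma embed_bit_simps [simp]: "embed_bit 0 = 0" "embed_bit 1 = 1" "embed_bit b = 0 \<longleftrightarrow> b = 0"
  by (simp_all add: embed_bit_def)

definition eval_bit :: "'a::comm_ring_1 \<Rightarrow> bit poly \<Rightarrow> 'a" where
  "eval_bit x p = poly (map_poly embed_bit p) x"

lemma eval_bit_0 [simp]: "eval_bit x 0 = 0"
  by (simp add: eval_bit_def)

lemma eval_bit_pCons [simp]: "eval_bit x (pCons a p) = embed_bit a + x * eval_bit x p"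
  by (simp add: eval_bit_def map_poly_pCons)

lemma eval_bit_1 [simp]: "eval_bit x 1 = 1"
  by (simp add: one_pCons)

lemma eval_bit_add:
  fixes x :: "'a::comm_ring_1"
  assumes "(2::'a) = 0" shows "eval_bit x (p + q) = eval_bit x p + eval_bit x q"
proof (induction p q rule: poly_induct2)
  case (pCons a p b q)
  have "embed_bit (a + b) = (embed_bit a + embed_bit b :: 'a)"
    by (cases a; cases b) (simp_all add: assms)
  with pCons show ?case by (simp add: algebra_simps)
qed simp

lemma eval_bit_smult: "eval_bit x (Polynomial.smult a p) = embed_bit a * eval_bit x p"
  by (cases a) simp_all

lemma eval_bit_mult:
  fixes x :: "'a::comm_ring_1"
  assumes "(2::'a) = 0" shows "eval_bit x (p * q) = eval_bit x p * eval_bit x q"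
  by (induction p) (simp_all add: eval_bit_add[OF assms] eval_bit_smult algebra_simps)

lemma eval_bit_monom: "eval_bit x (Polynomial.monom 1 n) = x ^ n"
  by (simp add: eval_bit_def map_poly_monom poly_monom)

lemma degree_monom_power_add:
  assumes "0 < m"
  shows "Polynomial.degree (Polynomial.monom (1::'b::comm_ring_1) (2 ^ m) + Polynomial.monom a 1) = 2 ^ m"
proof -
  have "1 < (2::nat) ^ m" using assms one_less_power[of "2::nat" m] by simp
  then show ?thesis
    by (subst degree_add_eq_left) (auto simp: degree_monom_eq intro: order.strict_trans1[OF degree_monom_le])
qed

text \<open>The analogue of \<open>eval_bit\<close> in a ring given by a carrier, by Horner's
  rule.\<close>

definition (in ring) reval :: "'a \<Rightarrow> bit poly \<Rightarrow> 'a" where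
  "reval x p = fold_coeffs (\<lambda>a v. (if a = 0 then \<zero> else \<one>) \<oplus> x \<otimes> v) p \<zero>"

context field
begin

lemma reval_0 [simp]: "reval x 0 = \<zero>"
  by (simp add: reval_def)

lemma reval_pCons:
  assumes "x \<in> carrier R"
  shows "reval x (pCons a p) = (if a = 0 then \<zero> else \<one>) \<oplus> x \<otimes> reval x p"
  using assms by (cases "p = 0 \<and> a = 0") (auto simp: reval_def)

lemma reval_closed [simp]: "x \<in> carrier R \<Longrightarrow> reval x p \<in> carrier R"
  by (induction p) (simp_all add: reval_pCons)

lemma reval_1: "x \<in> carrier R \<Longrightarrow> reval x 1 = \<one>"
  by (simp add: one_pCons reval_pCons)

lemma reval_add:
  assumes "\<one> \<oplus> \<one> = \<zero>" "x \<in> carrier R"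
  shows "reval x (p + q) = reval x p \<oplus> reval x q"
proof (induction p q rule: poly_induct2)
  case (pCons a p b q)
  have "(if a + b = 0 then \<zero> else \<one>) = (if a = 0 then \<zero> else \<one>) \<oplus> (if b = 0 then \<zero> else \<one>)"
    using assms(1) by (cases a; cases b) simp_all
  with pCons assms(2) show ?case
    by (simp add: reval_pCons r_distr a_ac del: add_bit_eq_xor)
qed simp

lemma reval_smult: "x \<in> carrier R \<Longrightarrow> reval x (Polynomial.smult a p) = (if a = 0 then \<zero> else reval x p)"
  by (cases a) simp_all

lemma reval_mult:
  assumes "\<one> \<oplus> \<one> = \<zero>" "x \<in> carrier R"
  shows "reval x (p * q) = reval x p \<otimes> reval x q"
proof (induction p)
  case (pCons a p)
  have "reval x (pCons a p * q) = (if a = 0 then \<zero> else reval x q) \<oplus> x \<otimes> (reval x p \<otimes> reval x q)"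
    using pCons assms by (simp add: reval_add reval_smult reval_pCons)
  also have "\<dots> = reval x (pCons a p) \<otimes> reval x q"
    using assms(2) by (simp add: reval_pCons l_distr m_assoc)
  finally show ?case .
qed (simp add: assms(2))

lemma reval_monom: "x \<in> carrier R \<Longrightarrow> reval x (Polynomial.monom 1 n) = x [^] n"
  by (induction n) (simp_all add: monom_Suc reval_pCons reval_1 monom_0 m_comm)

lemma finite_field_pow_card:
  assumes "finite (carrier R)" "x \<in> carrier R"
  shows "x [^] card (carrier R) = x"
proof (cases "x = \<zero>")
  case True
  have "card (carrier R) \<noteq> 0" using assms by auto
  then show ?thesis using True nat_pow_zero by simp
next
  case False
  have "x [^] (card (carrier R) - 1) = \<one>"
    using units_power_order_eq_one[of x] False assms by (simp add: field_Units)
  moreover have "card (carrier R) = Suc (card (carrier R) - 1)"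
    using assms by (metis Suc_pred' card_gt_0_iff empty_iff)
  ultimately show ?thesis using assms(2) by (metis l_one nat_pow_Suc)
qed

lemma finite_field_pow_card_power:
  assumes "finite (carrier R)" "x \<in> carrier R"
  shows "x [^] (card (carrier R) ^ k) = x"
proof (induction k)
  case (Suc k)
  then show ?case
    using assms finite_field_pow_card[OF assms]
    by (simp flip: nat_pow_pow[OF assms(2)])
qed (simp add: assms(2))

text \<open>The field has even order, so raising -1 to that order gives 1, but also returns
  -1.\<close>

lemma one_add_one_eq_zero:
  assumes "card (carrier R) = 2 ^ d"
  shows "\<one> \<oplus> \<one> = \<zero>"
proof -
  have fin: "finite (carrier R)" using assms by (simp add: card_ge_0_finite)
  have "2 \<le> card (carrier R)"
    using card_mono[OF fin, of "{\<zero>, \<one>}"] by simp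
  then have "d \<noteq> 0" using assms by (cases d) auto
  then obtain k where k: "card (carrier R) = 2 * k" using assms by (cases d) auto
  have "(\<ominus> \<one>) [^] (2 * k) = ((\<ominus> \<one>) [^] (2::nat)) [^] k" by (simp add: nat_pow_pow)
  also have "(\<ominus> \<one>) [^] (2::nat) = \<one>" by (simp add: numeral_2_eq_2 l_minus)
  finally have "\<ominus> \<one> = \<one>" using finite_field_pow_card[OF fin, of "\<ominus> \<one>"] by (simp add: k)
  then show ?thesis by (metis one_closed r_neg)
qed

text \<open>A generator \<open>g\<close> of the multiplicative group presents the field as a quotient of
  \<open>GF(2)[X]\<close>; the minimal polynomial of \<open>g\<close> divides \<open>X\<^bsup>2^m\<^esup> - X\<close> and hence has a root
  in every field with \<open>2^m\<close> elements, to which \<open>g\<close> can be mapped.\<close>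

lemma finite_field_char_2_embedding:
  assumes cardR: "card (carrier R) = 2 ^ d" and cardL: "card (UNIV :: 'l::{field,finite} set) = 2 ^ m"
    and "d dvd m"
  obtains \<phi> :: "'a \<Rightarrow> 'l::{field,finite}"
  where "bij_betw \<phi> (carrier R) {x. x ^ (2 ^ d) = x}" "\<phi> \<one> = 1"
    "\<And>x y. x \<in> carrier R \<Longrightarrow> y \<in> carrier R \<Longrightarrow> \<phi> (x \<otimes> y) = \<phi> x * \<phi> y"
    "\<And>x y. x \<in> carrier R \<Longrightarrow> y \<in> carrier R \<Longrightarrow> \<phi> (x \<oplus> y) = \<phi> x + \<phi> y"
proof -
  have fin: "finite (carrier R)" using cardR by (simp add: card_ge_0_finite)
  have char: "\<one> \<oplus> \<one> = \<zero>" using one_add_one_eq_zero[OF cardR] .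
  note char' = char_two_of_card[OF cardL]
  note add = reval_add[OF char] eval_bit_add[OF char']
  note mult = reval_mult[OF char] eval_bit_mult[OF char']
  obtain g where g: "g \<in> carrier R"
    and gen: "carrier (mult_of R) = {g [^] i | i::nat. i \<in> UNIV}"
    using finite_field_mult_group_has_gen[OF fin] by auto
  have surj: "\<exists>p. reval g p = x" if "x \<in> carrier R" for x
  proof (cases "x = \<zero>")
    case False
    with that have "x \<in> carrier (mult_of R)" by simp
    then obtain i :: nat where "x = g [^] i" unfolding gen by blast
    then show ?thesis using reval_monom[OF g] by metis
  qed (use reval_0 in blast)
  \<comment> \<open>In characteristic 2 this is \<open>X^(2^m) - X\<close>, which vanishes on all of
    \<open>'l\<close>, and at \<open>g\<close> because \<open>d\<close> divides
    \<open>m\<close>.\<close>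
  define Q :: "bit poly" where "Q = Polynomial.monom 1 (2 ^ m) + Polynomial.monom 1 1"
  have evQ: "eval_bit x Q = 0" for x :: 'l
    using power_card_UNIV[of x] char'
    by (simp add: Q_def add eval_bit_monom cardL flip: mult_2)
  have "d \<noteq> 0"
  proof
    assume "d = 0"
    then have "card (carrier R) = 1" using cardR by simp
    then show False using card_mono[OF fin, of "{\<zero>, \<one>}"] by simp
  qed
  have "m \<noteq> 0" using cardL card_mono[of UNIV "{0, 1::'l}"] by (cases "m = 0") auto
  then have degQ: "Polynomial.degree Q = 2 ^ m"
    unfolding Q_def by (intro degree_monom_power_add) simp
  then have "Q \<noteq> 0" by auto
  have reQ: "reval g Q = \<zero>"
  proof -
    obtain k where k: "m = d * k" using \<open>d dvd m\<close> by blast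
    have "g [^] (2 ^ m :: nat) = g"
      using finite_field_pow_card_power[OF fin g, of k] by (simp add: cardR k power_mult)
    then have "reval g Q = g \<otimes> (\<one> \<oplus> \<one>)"
      using g by (simp only: Q_def add(1)[OF g] reval_monom[OF g]) (simp add: r_distr)
    then show ?thesis using char g by simp
  qed
  \<comment> \<open>Minimal degree makes \<open>f\<close> a generator of the kernel of
    \<open>reval g\<close>, by division with remainder.\<close>
  obtain f where f: "f \<noteq> 0" "reval g f = \<zero>"
    and f_min: "\<And>p. p \<noteq> 0 \<Longrightarrow> reval g p = \<zero> \<Longrightarrow> Polynomial.degree f \<le> Polynomial.degree p"
    using ex_has_least_nat[of "\<lambda>f. f \<noteq> 0 \<and> reval g f = \<zero>" Q Polynomial.degree] \<open>Q \<noteq> 0\<close> reQ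
    by metis
  have f_dvd: "f dvd p" if "reval g p = \<zero>" for p
  proof (rule ccontr)
    assume "\<not> f dvd p"
    then have nz: "p mod f \<noteq> 0" by (simp add: mod_eq_0_iff_dvd)
    have "reval g p = reval g (p div f) \<otimes> reval g f \<oplus> reval g (p mod f)"
      using g by (simp flip: add mult)
    then have "reval g (p mod f) = \<zero>" using that f g by simp
    with f_min[OF nz] degree_mod_less[of f p] f(1) nz show False by auto
  qed
  \<comment> \<open>The cofactor of \<open>f\<close> in \<open>Q\<close> has degree below
    \<open>2^m\<close>, so it is nonzero somewhere; there \<open>f\<close> must vanish.\<close>
  obtain b :: 'l where b: "eval_bit b f = 0"
  proof -
    obtain q where q: "Q = f * q" using f_dvd[OF reQ] by blast
    have "q \<noteq> 0" using \<open>Q \<noteq> 0\<close> q by auto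
    have "Polynomial.degree f \<noteq> 0"
    proof
      assume "Polynomial.degree f = 0"
      then have "f = 1" using f(1) by (auto simp: one_pCons elim!: degree_eq_zeroE)
      then show False using f(2) g by (simp add: reval_1)
    qed
    then have "Polynomial.degree q < 2 ^ m" using degree_mult_eq[OF f(1) \<open>q \<noteq> 0\<close>] degQ q by simp
    moreover have "card {x::'l. poly (map_poly embed_bit q) x = 0} \<le> Polynomial.degree (map_poly embed_bit q :: 'l poly)"
      using \<open>q \<noteq> 0\<close> by (intro card_poly_roots_bound) (simp add: map_poly_eq_0_iff)
    moreover have "Polynomial.degree (map_poly embed_bit q :: 'l poly) = Polynomial.degree q" by (simp add: degree_map_poly)
    ultimately have "{x::'l. eval_bit x q = 0} \<noteq> UNIV" using cardL by (auto simp: eval_bit_def)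
    then obtain x :: 'l where "eval_bit x q \<noteq> 0" by blast
    moreover have "eval_bit x f * eval_bit x q = 0" using evQ[of x] by (simp add: q mult)
    ultimately show thesis using that by auto
  qed
  \<comment> \<open>The choice of \<open>p\<close> is immaterial: two candidates differ by a
    multiple of \<open>f\<close>, which vanishes at \<open>b\<close>.\<close>
  define \<phi> where "\<phi> x = eval_bit b (SOME p. reval g p = x)" for x
  have \<phi>: "\<phi> (reval g p) = eval_bit b p" for p
  proof -
    define p' where "p' = (SOME p'. reval g p' = reval g p)"
    have p': "reval g p' = reval g p" unfolding p'_def by (rule someI) simp
    have "reval g (p' + p) = reval g p \<otimes> (\<one> \<oplus> \<one>)" using g p' by (simp add: add r_distr)
    then have "reval g (p' + p) = \<zero>" using char g by simp
    then obtain q where "p' + p = f * q" using f_dvd by blast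
    then have "eval_bit b p' + eval_bit b p = 0" using b by (simp add: mult flip: add)
    moreover have "eval_bit b p + eval_bit b p = 0" using char' by (simp flip: mult_2)
    ultimately have "eval_bit b p' = eval_bit b p" by (metis add_right_cancel)
    then show ?thesis by (simp add: \<phi>_def p'_def)
  qed
  have m: "\<phi> (x \<otimes> y) = \<phi> x * \<phi> y" and a: "\<phi> (x \<oplus> y) = \<phi> x + \<phi> y"
    if "x \<in> carrier R" "y \<in> carrier R" for x y
    using surj[OF that(1)] surj[OF that(2)] g by (auto simp: \<phi> mult add simp flip: mult add)
  have one: "\<phi> \<one> = 1" using \<phi>[of 1] g by (simp add: reval_1)
  have zero: "\<phi> \<zero> = 0" using \<phi>[of 0] by simp
  have inj: "inj_on \<phi> (carrier R)"
  proof (rule inj_onI)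
    fix x y assume xy: "x \<in> carrier R" "y \<in> carrier R" "\<phi> x = \<phi> y"
    have "\<phi> (x \<ominus> y) = 0"
    proof -
      have "\<phi> (x \<ominus> y) + \<phi> y = \<phi> x" using xy a[of "x \<ominus> y" y] by (simp add: minus_eq a_assoc l_neg)
      with xy(3) show ?thesis by simp
    qed
    have "x \<ominus> y = \<zero>"
    proof (rule ccontr)
      assume "x \<ominus> y \<noteq> \<zero>"
      then have "x \<ominus> y \<in> Units R" using xy by (simp add: field_Units)
      then have "\<phi> (x \<ominus> y) * \<phi> (inv (x \<ominus> y)) = 1"
        using xy one by (simp flip: m)
      then show False using \<open>\<phi> (x \<ominus> y) = 0\<close> by simp
    qed
    then show "x = y" using xy by simp
  qed
  have pow: "\<phi> (x [^] n) = \<phi> x ^ n" if "x \<in> carrier R" for x and n :: nat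
    using that by (induction n) (simp_all add: one m)
  let ?K = "{x::'l. x ^ (2 ^ d) = x}"
  have "\<phi> ` carrier R \<subseteq> ?K"
    using finite_field_pow_card[OF fin] cardR by (auto simp flip: pow)
  \<comment> \<open>The target is the root set of a polynomial of degree \<open>2^d\<close>, so the
    injective image fills it.\<close>
  moreover have "card ?K \<le> card (\<phi> ` carrier R)"
  proof -
    define P :: "'l poly" where "P = Polynomial.monom 1 (2 ^ d) + Polynomial.monom (- 1) 1"
    have "Polynomial.degree P = 2 ^ d"
      unfolding P_def using \<open>d \<noteq> 0\<close> by (intro degree_monom_power_add) simp
    then have "Polynomial.degree P \<le> 2 ^ d" "P \<noteq> 0" by auto
    then have "card {x. poly P x = 0} \<le> 2 ^ d" using card_poly_roots_bound[of P] by linarith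
    then show ?thesis using card_image[OF inj] cardR by (simp add: P_def poly_monom)
  qed
  ultimately have "\<phi> ` carrier R = ?K" by (intro card_seteq) auto
  with inj have "bij_betw \<phi> (carrier R) ?K" by (simp add: bij_betw_def)
  from that[OF this one m a] show thesis by blast
qed

end

section \<open>Fixed fields of Frobenius powers\<close>

lemma fixed_by_power_gcd:
  fixes x :: "'a::monoid_mult"
  assumes "x ^ (2 ^ m) = x" "x ^ (2 ^ s) = x"
  shows "x ^ (2 ^ gcd m s) = x"
proof (cases "m = 0")
  case False
  have iter: "x ^ (2 ^ (n * k)) = x" if "x ^ (2 ^ n) = x" for n k
    by (induction k) (simp_all add: that power_add power_mult)
  \<comment> \<open>Raising to the power \<open>2^(m*u)\<close> fixes \<open>x\<close>; after
    removing the part \<open>2^(s*v)\<close>, which also fixes \<open>x\<close>, only the gcd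
    remains.\<close>
  obtain u v where "m * u = s * v + gcd m s" using bezout_nat[OF False] by blast
  then have "x ^ (2 ^ (s * v) * 2 ^ gcd m s) = x" using iter[OF assms(1), of u] by (simp add: power_add)
  then show ?thesis by (metis power_mult iter[OF assms(2)])
qed (use assms in simp)

lemma fixed_by_power_gcd_iff:
  fixes x :: "'a::{field,finite}"
  assumes "card (UNIV :: 'a set) = 2 ^ m"
  shows "x ^ (2 ^ s) = x \<longleftrightarrow> x ^ (2 ^ gcd m s) = x"
proof
  assume *: "x ^ (2 ^ gcd m s) = x"
  obtain k where k: "s = gcd m s * k" by (metis dvdE gcd_dvd2)
  have "x ^ (2 ^ (gcd m s * n)) = x" for n
    by (induction n) (simp_all add: * power_add power_mult)
  with k show "x ^ (2 ^ s) = x" by metis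
qed (use fixed_by_power_gcd power_card_UNIV[of x] assms in metis)

section \<open>The Frobenius case\<close>

lemma power_two_power_add:
  fixes x y :: "'a::comm_ring_1"
  assumes "(2::'a) = 0"
  shows "(x + y) ^ (2 ^ n) = x ^ (2 ^ n) + y ^ (2 ^ n)"
proof (induction n)
  case (Suc n)
  have "(u + v) ^ 2 = u ^ 2 + v ^ 2" for u v :: 'a
    using assms by (simp add: power2_sum)
  then show ?case by (simp add: Suc power_mult mult.commute[of 2])
qed simp

lemma is_identity_the:
  assumes "is_identity star e" shows "(THE e. is_identity star e) = e"
  using assms by (rule the_equality) (metis assms is_identity_def)

lemma twisted_form_frobenius:
  fixes l :: "'a::{field,finite}"
  assumes "card (UNIV :: 'a set) = 2 ^ m" and "0 < s" and "s < m"
    and "legitimate s (p1, p2, p3, p4)"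
    and "l \<noteq> 0" and "l \<notin> {u ^ (2 ^ s - 1) | u. u \<noteq> 0}"
  shows "twisted_form (\<lambda>x. x ^ (2 ^ s)) l p1 p2 p3 p4"
proof
  show two: "(2::'a) = 0" using char_two_of_card[OF assms(1)] .
  show "(x + y) ^ (2 ^ s) = x ^ (2 ^ s) + y ^ (2 ^ s)" for x y :: 'a
    by (rule power_two_power_add[OF two])
  show "\<exists>x::'a. x ^ (2 ^ s) \<noteq> x"
  proof (rule ccontr)
    assume "\<not> ?thesis"
    then have UNIV: "{x::'a. x ^ (2 ^ s) = x} = UNIV" by auto
    \<comment> \<open>A trivial \<open>\<sigma>\<close> would give this polynomial of degree
      \<open>2^s\<close> as many as \<open>2^m\<close> roots.\<close>
    define P :: "'a poly" where "P = Polynomial.monom 1 (2 ^ s) + Polynomial.monom (- 1) 1"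
    have "Polynomial.degree P = 2 ^ s"
      unfolding P_def using \<open>0 < s\<close> by (rule degree_monom_power_add)
    then have "card {x. poly P x = 0} \<le> 2 ^ s" using card_poly_roots_bound[of P] by fastforce
    then show False using UNIV assms(1) \<open>s < m\<close> by (simp add: P_def poly_monom)
  qed
  show "u ^ (2 ^ s) \<noteq> l * u" if "u \<noteq> 0" for u
  proof
    assume "u ^ (2 ^ s) = l * u"
    then have "u ^ (2 ^ s - 1) * u = l * u" by (simp flip: power_Suc2)
    then have "l = u ^ (2 ^ s - 1)" using that by simp
    with that assms(6) show False by blast
  qed
  show "p1 \<noteq> 0" using assms(4) by simp
  show "p1 * (x * x ^ (2 ^ s)) + p2 * x ^ (2 ^ s) + p3 * x + p4 \<noteq> 0" for x
    using assms(4) by simp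
qed (use assms(5) in \<open>simp_all add: power_mult_distrib\<close>)

theorem theorem8:
  fixes m s :: nat
    and l :: "'a::{field,finite}"
    and t :: "'a \<times> 'a \<times> 'a \<times> 'a"
    and star :: "'b::{ab_group_add,finite} \<Rightarrow> 'b \<Rightarrow> 'b"
    and K1 :: "'k ring"
  assumes "card (UNIV :: 'a set) = 2 ^ m"
    and "0 < s" and "s < m"
    and "legitimate s t"
    and "l \<noteq> 0" and "l \<notin> {u ^ (2 ^ s - 1) | u. u \<noteq> 0}"
    and "semifield star"
    and "isotopic star (B_mult s l t)"
    and "field K1" and "card (carrier K1) = 2 ^ gcd m s"
  shows "center star = left_nucleus star \<and> left_nucleus star = right_nucleus star \<and>
         substructure star (center star) \<simeq> K1"
proof -
  obtain p1 p2 p3 p4 where t: "t = (p1, p2, p3, p4)" by (cases t)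
  interpret twisted_form "\<lambda>x. x ^ (2 ^ s)" l p1 p2 p3 p4
    by (rule twisted_form_frobenius[OF assms(1-3) assms(4)[unfolded t] assms(5,6)])
  have B_circ: "B_mult s l t = circ"
  proof (intro ext)
    show "B_mult s l t x y = circ x y" for x y
      by (cases x; cases y) (simp add: t F_def Let_def)
  qed
  have iso: "isotopic star circ" by (rule assms(8)[unfolded B_circ])
  show ?thesis
  proof (rule isotope_nuclei[OF assms(7) iso])
    fix \<zeta> :: "'a \<Rightarrow> 'b"
    assume \<zeta>: "inj \<zeta>" "is_identity star (\<zeta> 1)" "\<And>j k. \<zeta> (j + k) = \<zeta> j + \<zeta> k"
      "\<And>j k. j ^ (2 ^ s) = j \<Longrightarrow> k ^ (2 ^ s) = k \<Longrightarrow> \<zeta> (j * k) = star (\<zeta> j) (\<zeta> k)"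
      and Z: "center star = \<zeta> ` {k. k ^ (2 ^ s) = k}" "left_nucleus star = \<zeta> ` {k. k ^ (2 ^ s) = k}"
        "right_nucleus star = \<zeta> ` {k. k ^ (2 ^ s) = k}"
    interpret K1: field K1 by fact
    show ?thesis
    proof (rule K1.finite_field_char_2_embedding[OF assms(10,1) gcd_dvd1])
      fix \<phi> :: "'k \<Rightarrow> 'a"
      assume \<phi>: "bij_betw \<phi> (carrier K1) {x. x ^ (2 ^ gcd m s) = x}" "\<phi> \<one>\<^bsub>K1\<^esub> = 1"
        "\<And>x y. x \<in> carrier K1 \<Longrightarrow> y \<in> carrier K1 \<Longrightarrow> \<phi> (x \<otimes>\<^bsub>K1\<^esub> y) = \<phi> x * \<phi> y"
        "\<And>x y. x \<in> carrier K1 \<Longrightarrow> y \<in> carrier K1 \<Longrightarrow> \<phi> (x \<oplus>\<^bsub>K1\<^esub> y) = \<phi> x + \<phi> y"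
      have \<phi>_bij: "bij_betw \<phi> (carrier K1) {x. x ^ (2 ^ s) = x}"
        using \<phi>(1) by (simp add: fixed_by_power_gcd_iff[OF assms(1), where s = s])
      then have \<phi>_fixed: "\<phi> x ^ (2 ^ s) = \<phi> x" if "x \<in> carrier K1" for x
        using that by (auto simp: bij_betw_def)
      \<comment> \<open>\<open>\<phi>\<close> identifies \<open>K1\<close> with the fixed field of
        \<open>\<sigma>\<close>, and \<open>\<zeta>\<close> carries that onto the center.\<close>
      have "\<zeta> \<circ> \<phi> \<in> ring_iso K1 (substructure star (center star))"
      proof (rule ring_iso_memI)
        show "bij_betw (\<zeta> \<circ> \<phi>) (carrier K1) (carrier (substructure star (center star)))"
          using bij_betw_trans[OF \<phi>_bij inj_on_imp_bij_betw[OF inj_on_subset[OF \<zeta>(1) subset_UNIV]]]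
          by (simp add: substructure_def Z(1))
        then show "(\<zeta> \<circ> \<phi>) x \<in> carrier (substructure star (center star))" if "x \<in> carrier K1" for x
          using that by (auto simp: bij_betw_def)
      qed (simp_all add: substructure_def \<phi> \<zeta>(3,4) \<phi>_fixed is_identity_the[OF \<zeta>(2)])
      \<comment> \<open>The isomorphism was built starting from \<open>K1\<close>, whose ring axioms
        are at hand, and is now inverted.\<close>
      then have "substructure star (center star) \<simeq> K1"
        using ring_iso_set_sym[OF K1.ring_axioms] unfolding is_ring_iso_def by blast
      with Z show ?thesis by simp
    qed
  qed
qed

end
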